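(* Let $\sigma>0$, $\varepsilon>0$, $\Delta x>0$, $\Delta t>0$. Consider the ImEx2-ctr scheme together with either periodic boundary conditions or hybrid Dirichlet–Neumann boundary conditions (with imposed boundary values $E_L,E_R$), and set $\tilde u_j^n=\sqrt{M_2}\,E_j^n+\sqrt{M_1}\,F_j^n$, $\tilde v_j^n=\sqrt{M_2}\,E_j^n-\sqrt{M_1}\,F_j^n$. Then the scheme is $l^\infty$-diminishing for the variables $\tilde u,\tilde v$, that is, $$\max_{1\le j\le N}\left(|\tilde u_j^{n+1}|,|\tilde v_j^{n+1}|\right)\le\max_{1\le j\le N}\left(|\tilde u_j^{n}|,|\tilde v_j^{n}|\right),$$ provided that $$\Delta t_{min}:=\varepsilon\Delta x+\frac{\sigma\Delta x^2}{6}\ \le\ \Delta t\ \le\ \Delta t_{max}:=\frac{\sigma\Delta x^2}{9/2}\cdot\frac{1+\sqrt{1+\frac92\left(\frac{2\varepsilon}{\sigma\Delta x}\right)^2}}{2}.$$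
   Context: The unknowns are real grid values $E_j^n,F_j^n$ with cells $1\le j\le N$ and time levels $n\ge0$; $\sigma$ is constant, $\Delta x$ is the mesh size and $\Delta t$ the time step. With $s=\frac{\sigma\Delta t}{\varepsilon^2}$, put $$M_1=\frac{1}{1+\frac s2\left(1+\frac s2\right)},\quad M_1^+=\frac{1+\frac s2}{1+\frac s2\left(1+\frac s2\right)},\quad M_2=\frac{1+\frac s2}{1+s\left(1+\frac s2\right)},\quad M_2^+=\frac{1+s}{1+s\left(1+\frac s2\right)}.$$ The ImEx2-ctr scheme (for the hyperbolic heat equations $\partial_tE+\frac1\varepsilon\partial_xF=0$, $\partial_tF+\frac1\varepsilon\partial_xE=-\frac{\sigma}{\varepsilon^2}F$) is, for $1\le j\le N$, $n\ge0$, $$\frac{E_j^{n+1}-E_j^n}{\Delta t}+\frac{M_1}{\varepsilon}\frac{F_{j+1}^n-F_{j-1}^n}{2\Delta x}-\frac{M_1^+\Delta t}{2\varepsilon^2}\frac{E_{j+1}^n-2E_j^n+E_{j-1}^n}{\Delta x^2}=0,$$ $$\frac{F_j^{n+1}-F_j^n}{\Delta t}+\frac{M_2}{\varepsilon}\frac{E_{j+1}^n-E_{j-1}^n}{2\Delta x}-\frac{M_2^+\Delta t}{2\varepsilon^2}\frac{F_{j+1}^n-2F_j^n+F_{j-1}^n}{\Delta x^2}=-\frac{\sigma M_2}{\varepsilon^2}\,\frac{F_{j+1}^n+4F_j^n+F_{j-1}^n}{6}.$$ The ghost values at $j=0$ and $j=N+1$ are given, at each time level $n$, by the boundary conditions.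 Periodic: $E_0^n=E_N^n$, $F_0^n=F_N^n$, $E_{N+1}^n=E_1^n$, $F_{N+1}^n=F_1^n$. Hybrid Dirichlet–Neumann: $\frac{E_0^n+E_1^n}{2}=E_L$, $\frac{F_1^n-F_0^n}{\Delta x}=0$, $\frac{E_N^n+E_{N+1}^n}{2}=E_R$, $\frac{F_{N+1}^n-F_N^n}{\Delta x}=0$, where $E_L,E_R$ are the constant values imposed on $E$ at the left and right boundaries.
   Formalization: For hybrid conditions the inequality is proved only for E_L=E_R=0, since it fails for other imposed values (start from E=F=0 in all cells); for arbitrary E_L,E_R it is proved for the difference of two solutions with the same imposed values. *)

theory Defs
  imports Complex_Main
begin

(* Grid functions are maps  time level => cell index => real.  Only the indices 0..N+1 matter:
   1..N are the cells, 0 and N+1 the ghost cells. *)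
type_synonym grid = "nat \<Rightarrow> nat \<Rightarrow> real"

definition stiffness :: "real \<Rightarrow> real \<Rightarrow> real \<Rightarrow> real" where
  "stiffness \<sigma> \<epsilon> \<Delta>t = \<sigma> * \<Delta>t / \<epsilon>^2"

(* The four coefficients, as functions of s = stiffness. *)

definition M1 :: "real \<Rightarrow> real" where
  "M1 s = 1 / (1 + s/2 * (1 + s/2))"

definition M1_plus :: "real \<Rightarrow> real" where
  "M1_plus s = (1 + s/2) / (1 + s/2 * (1 + s/2))"

definition M2 :: "real \<Rightarrow> real" where
  "M2 s = (1 + s/2) / (1 + s * (1 + s/2))"

definition M2_plus :: "real \<Rightarrow> real" where
  "M2_plus s = (1 + s) / (1 + s * (1 + s/2))"

(* Index subtraction on nat is never truncated here, since j >= 1. *)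
definition imex2_ctr :: "real \<Rightarrow> real \<Rightarrow> real \<Rightarrow> real \<Rightarrow> nat \<Rightarrow> grid \<Rightarrow> grid \<Rightarrow> bool" where
  "imex2_ctr \<sigma> \<epsilon> \<Delta>x \<Delta>t N E F \<longleftrightarrow>
    (let s = stiffness \<sigma> \<epsilon> \<Delta>t in
     \<forall>n. \<forall>j\<in>{1..N}.
       (E (n+1) j - E n j) / \<Delta>t
         + M1 s / \<epsilon> * ((F n (j+1) - F n (j-1)) / (2 * \<Delta>x))
         - M1_plus s * \<Delta>t / (2 * \<epsilon>^2) * ((E n (j+1) - 2 * E n j + E n (j-1)) / \<Delta>x^2) = 0
     \<and>
       (F (n+1) j - F n j) / \<Delta>t
         + M2 s / \<epsilon> * ((E n (j+1) - E n (j-1)) / (2 * \<Delta>x))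
         - M2_plus s * \<Delta>t / (2 * \<epsilon>^2) * ((F n (j+1) - 2 * F n j + F n (j-1)) / \<Delta>x^2)
       = - (\<sigma> * M2 s / \<epsilon>^2) * ((F n (j+1) + 4 * F n j + F n (j-1)) / 6))"

definition periodic_bc :: "nat \<Rightarrow> grid \<Rightarrow> grid \<Rightarrow> bool" where
  "periodic_bc N E F \<longleftrightarrow>
    (\<forall>n. E n 0 = E n N \<and> F n 0 = F n N \<and> E n (N+1) = E n 1 \<and> F n (N+1) = F n 1)"

(* The statement treats E_L = E_R = 0 separately for hybrid conditions.  Otherwise the scheme is
   affine, not linear, and diminishing fails: E = F = 0 in all cells at level n gives a nonzero
   level n+1, whatever (E_L, E_R) other than (0, 0) is imposed.  What holds for arbitrary imposed
   values is the inequality for the difference of two solutions sharing them. *)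
definition hybrid_bc :: "real \<Rightarrow> real \<Rightarrow> real \<Rightarrow> nat \<Rightarrow> grid \<Rightarrow> grid \<Rightarrow> bool" where
  "hybrid_bc \<Delta>x E_L E_R N E F \<longleftrightarrow>
    (\<forall>n. (E n 0 + E n 1) / 2 = E_L \<and> (F n 1 - F n 0) / \<Delta>x = 0 \<and>
         (E n N + E n (N+1)) / 2 = E_R \<and> (F n (N+1) - F n N) / \<Delta>x = 0)"

definition u_tilde :: "real \<Rightarrow> grid \<Rightarrow> grid \<Rightarrow> grid" where
  "u_tilde s E F n j = sqrt (M2 s) * E n j + sqrt (M1 s) * F n j"

definition v_tilde :: "real \<Rightarrow> grid \<Rightarrow> grid \<Rightarrow> grid" where
  "v_tilde s E F n j = sqrt (M2 s) * E n j - sqrt (M1 s) * F n j"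

(* Meaningful for N >= 1 only (Max of a nonempty set). *)
definition linf_diminishing :: "nat \<Rightarrow> grid \<Rightarrow> grid \<Rightarrow> bool" where
  "linf_diminishing N u v \<longleftrightarrow>
    (\<forall>n. Max ((\<lambda>j. max \<bar>u (n+1) j\<bar> \<bar>v (n+1) j\<bar>) ` {1..N})
         \<le> Max ((\<lambda>j. max \<bar>u n j\<bar> \<bar>v n j\<bar>) ` {1..N}))"

definition \<Delta>t_min :: "real \<Rightarrow> real \<Rightarrow> real \<Rightarrow> real" where
  "\<Delta>t_min \<sigma> \<epsilon> \<Delta>x = \<epsilon> * \<Delta>x + \<sigma> * \<Delta>x^2 / 6"

definition \<Delta>t_max :: "real \<Rightarrow> real \<Rightarrow> real \<Rightarrow> real" where
  "\<Delta>t_max \<sigma> \<epsilon> \<Delta>x =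
     \<sigma> * \<Delta>x^2 / (9/2) * ((1 + sqrt (1 + 9/2 * (2 * \<epsilon> / (\<sigma> * \<Delta>x))^2)) / 2)"

end

theory Submission
  imports Defs
begin

text \<open>With \<open>x = \<Delta>t / (\<epsilon> * \<Delta>x)\<close>, the two bounds on the time step become
  \<open>x + s/6 \<le> x^2\<close> and \<open>x^2 \<le> 2 * (1 + s) / 9\<close>. They make every coefficient
  nonnegative when the new \<open>u\<close> and \<open>v\<close> in a cell are written in terms of the old \<open>u\<close> and \<open>v\<close> in
  that cell and its two neighbours; the coefficients sum to \<open>1\<close>, so the new values are convex
  combinations of old ones. A ghost value is, up to sign, one of the values in the cells
  (homogeneous hybrid conditions exchange \<open>u\<close> and \<open>v\<close>, with a sign), so the maximum
  does not grow. For arbitrary imposed values, the difference of two solutions is a solution of the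
  homogeneous problem.\<close>

section \<open>Signs and ordering of the scheme coefficients\<close>

lemma M1_pos: "s \<ge> 0 \<Longrightarrow> M1 s > 0" and M2_pos: "s \<ge> 0 \<Longrightarrow> M2 s > 0"
  unfolding M1_def M2_def by (auto intro!: divide_pos_pos add_pos_nonneg)

lemma M1_le_M1_plus: "s \<ge> 0 \<Longrightarrow> M1 s \<le> M1_plus s"
  unfolding M1_def M1_plus_def by (rule divide_right_mono) auto

lemma M2_le_M2_plus: "s \<ge> 0 \<Longrightarrow> M2 s \<le> M2_plus s"
  unfolding M2_def M2_plus_def by (rule divide_right_mono) auto

text \<open>After cross-multiplication the constant, linear and cubic terms of the numerator cancel.
  The exact value is needed as well as its sign: the factor \<open>s^2\<close> is what allows a
  comparison with a multiple of \<open>s * M2 s\<close>.\<close>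

lemma M1_plus_diff_M2_plus:
  assumes "s \<ge> 0"
  shows "M1_plus s - M2_plus s
    = (s^2 / 4) / ((1 + s/2 * (1 + s/2)) * (1 + s * (1 + s/2)))"
proof -
  have "1 + s/2 * (1 + s/2) > 0" "1 + s * (1 + s/2) > 0"
    using assms by (auto intro!: add_pos_nonneg)
  then have "M1_plus s - M2_plus s = ((1 + s/2) * (1 + s * (1 + s/2)) - (1 + s) * (1 + s/2 * (1 + s/2)))
      / ((1 + s/2 * (1 + s/2)) * (1 + s * (1 + s/2)))"
    unfolding M1_plus_def M2_plus_def by (intro diff_frac_eq) auto
  also have "(1 + s/2) * (1 + s * (1 + s/2)) - (1 + s) * (1 + s/2 * (1 + s/2)) = s^2 / 4"
    by (simp add: field_simps power2_eq_square)
  finally show ?thesis .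
qed

lemma M2_plus_le_M1_plus: "s \<ge> 0 \<Longrightarrow> M2_plus s \<le> M1_plus s"
  using M1_plus_diff_M2_plus[of s] by (simp add: algebra_simps)

section \<open>Nonnegativity of the weights\<close>

text \<open>Weight of the old \<open>u\<close> of a cell in its new \<open>u\<close>. The upper
  bound on \<open>x^2\<close> turns the factor \<open>x^2 / 2\<close> into
  \<open>(1 + s) / 9\<close>. The budget 1 is then split: the \<open>M1_plus\<close> term takes at
  most 1/3, and the other two, which share the denominator \<open>D2\<close>, take at most
  2/3.\<close>

lemma coefficient_same_cell_same_variable:
  assumes "s \<ge> 0" "x^2 \<le> 2 * (1 + s) / 9"
  shows "x^2 / 2 * (M1_plus s + M2_plus s) + s * M2 s / 3 \<le> 1"
proof -
  define D1 where "D1 = 1 + s/2 * (1 + s/2)"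
  define D2 where "D2 = 1 + s * (1 + s/2)"
  have pos: "D1 > 0" "D2 > 0"
    using assms unfolding D1_def D2_def by (auto intro!: add_pos_nonneg)
  have "3 * D1 = (1 + s) * (1 + s/2) + (2 + s^2 / 4)"
    by (simp add: D1_def field_simps power2_eq_square)
  then have "(1 + s) * (1 + s/2) \<le> 3 * D1"
    by simp
  then have 1: "(1 + s) * M1_plus s \<le> 3"
    using pos(1) unfolding M1_plus_def D1_def[symmetric]
    by (simp only: times_divide_eq_right pos_divide_le_eq)
  have "(1 + s) * (1 + s) / 3 + s * (1 + s/2) \<le> 2 * D2"
    using assms(1) by (simp add: D2_def field_simps)
  then have "((1 + s) * (1 + s) / 3 + s * (1 + s/2)) / D2 \<le> 2"
    using pos(2) by (simp only: pos_divide_le_eq)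
  moreover have "((1 + s) * (1 + s) / 3 + s * (1 + s/2)) / D2 = (1 + s) * M2_plus s / 3 + s * M2 s"
    unfolding M2_plus_def M2_def D2_def[symmetric] by (simp add: add_divide_distrib algebra_simps)
  ultimately have 2: "(1 + s) * M2_plus s / 9 + s * M2 s / 3 \<le> 2/3"
    by linarith
  have "x^2 / 2 * (M1_plus s + M2_plus s) \<le> (1 + s) / 9 * (M1_plus s + M2_plus s)"
    using assms M1_le_M1_plus[of s] M2_le_M2_plus[of s] M1_pos[of s] M2_pos[of s]
    by (intro mult_right_mono) auto
  also have "\<dots> = (1 + s) * M1_plus s / 9 + (1 + s) * M2_plus s / 9"
    by (simp add: field_simps)
  finally show ?thesis using 1 2 by linarith
qed

text \<open>Weight of the old \<open>v\<close> of a cell in its new \<open>u\<close>; the upper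
  bound on \<open>x^2\<close> is used again.\<close>

lemma coefficient_same_cell_other_variable:
  assumes "s \<ge> 0" "x^2 \<le> 2 * (1 + s) / 9"
  shows "x^2 / 2 * (M1_plus s - M2_plus s) \<le> s * M2 s / 3"
proof -
  define D1 where "D1 = 1 + s/2 * (1 + s/2)"
  define D2 where "D2 = 1 + s * (1 + s/2)"
  have pos: "D1 > 0" "D2 > 0"
    using assms unfolding D1_def D2_def by (auto intro!: add_pos_nonneg)
  \<comment> \<open>This is the claim multiplied by \<open>D1 * D2\<close> with one factor
    \<open>s\<close> removed. Multiplying \<open>s\<close> back in afterwards avoids a separate case
    \<open>s = 0\<close>.\<close>
  have "x^2 / 2 * (s/4) \<le> (1 + s) / 9 * (s/4)"
    using assms by (intro mult_right_mono) auto
  also have "\<dots> \<le> (1 + s/2) / 3 * D1"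
    using assms(1) by (simp add: D1_def field_simps add_nonneg_nonneg)
  finally have "x^2 / 2 * (s/4) * s \<le> (1 + s/2) / 3 * D1 * s"
    using assms(1) by (rule mult_right_mono)
  then have "x^2 / 2 * (s^2 / 4) / (D1 * D2) \<le> (1 + s/2) / 3 * D1 * s / (D1 * D2)"
    using pos by (intro divide_right_mono) (auto simp: power2_eq_square mult.assoc)
  then show ?thesis
    using pos unfolding M1_plus_diff_M2_plus[OF assms(1)] M2_def D1_def[symmetric] D2_def[symmetric]
    by (simp add: mult_ac)
qed

text \<open>Weight of a neighbour, and the place where the lower bound on the time step enters. By
  the arithmetic-geometric mean inequality and the ordering of the coefficients, the mean
  \<open>A\<close> of \<open>M1_plus s\<close> and \<open>M2_plus s\<close> dominates both
  \<open>sqrt (M1 s * M2 s)\<close> and \<open>M2 s\<close>, so the left side is at most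
  \<open>(x + s/6) * A\<close>.\<close>

lemma coefficient_neighbour_same_variable:
  assumes "s \<ge> 0" "x \<ge> 0" "x + s/6 \<le> x^2"
  shows "x * sqrt (M1 s * M2 s) + s * M2 s / 6 \<le> x^2 / 2 * (M1_plus s + M2_plus s)"
proof -
  define A where "A = (M1_plus s + M2_plus s) / 2"
  have A: "M2 s \<le> A" "(M1 s + M2 s) / 2 \<le> A" "A \<ge> 0"
    using M1_le_M1_plus[of s] M2_le_M2_plus[of s] M2_plus_le_M1_plus[of s]
      M1_pos[of s] M2_pos[of s] assms(1) unfolding A_def by auto
  have "sqrt (M1 s * M2 s) \<le> (M1 s + M2 s) / 2"
    using M1_pos[OF assms(1)] M2_pos[OF assms(1)] by (intro arith_geo_mean_sqrt) auto
  then have "x * sqrt (M1 s * M2 s) \<le> x * A"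
    using A assms by (intro mult_left_mono) auto
  moreover have "s/6 * M2 s \<le> s/6 * A"
    using A assms by (intro mult_left_mono) auto
  moreover have "(x + s/6) * A \<le> x^2 * A"
    using A assms by (intro mult_right_mono) auto
  moreover have "x^2 / 2 * (M1_plus s + M2_plus s) = x^2 * A"
    by (simp add: A_def)
  ultimately show ?thesis
    by (simp only: distrib_right)
qed

section \<open>Time step bounds in dimensionless form\<close>

text \<open>The two inequalities differ by the positive factor
  \<open>x / (\<epsilon> * \<Delta>x)\<close>.\<close>

lemma \<Delta>t_min_iff:
  fixes \<sigma> \<epsilon> \<Delta>x \<Delta>t :: real
  assumes "\<epsilon> > 0" "\<Delta>x > 0" "\<Delta>t > 0"
  defines "x \<equiv> \<Delta>t / (\<epsilon> * \<Delta>x)"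
  shows "\<Delta>t_min \<sigma> \<epsilon> \<Delta>x \<le> \<Delta>t \<longleftrightarrow> x + stiffness \<sigma> \<epsilon> \<Delta>t / 6 \<le> x^2"
proof -
  have x: "x > 0" and \<Delta>t: "\<Delta>t = x * (\<epsilon> * \<Delta>x)"
    using assms by (auto simp: x_def)
  have "x + stiffness \<sigma> \<epsilon> \<Delta>t / 6 = x / (\<epsilon> * \<Delta>x) * \<Delta>t_min \<sigma> \<epsilon> \<Delta>x"
    using assms(1,2) unfolding stiffness_def \<Delta>t_min_def \<Delta>t
    by (simp add: field_simps power2_eq_square)
  moreover have "x^2 = x / (\<epsilon> * \<Delta>x) * \<Delta>t"
    using assms(1,2) unfolding \<Delta>t by (simp add: power2_eq_square)
  ultimately show ?thesis
    using x assms(1,2) by (simp only: mult_le_cancel_left_pos divide_pos_pos mult_pos_pos)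
qed

text \<open>The bound on \<open>t\<close> is the larger root of
  \<open>t^2 - A * t - A^2 * q / 4\<close>. The smaller root is at most 0, so \<open>t\<close> lies
  between the roots, where the quadratic is nonpositive.\<close>

lemma le_positive_root_imp:
  fixes t A q :: real
  assumes "0 \<le> A" "0 \<le> q" "0 \<le> t" "t \<le> A * ((1 + sqrt (1 + q)) / 2)"
  shows "t^2 \<le> A * t + A^2 * q / 4"
proof -
  define r where "r = sqrt (1 + q)"
  have r: "r^2 = 1 + q" "r \<ge> 1" using assms by (auto simp: r_def)
  have "A * 1 \<le> A * r"
    using r assms by (intro mult_left_mono) auto
  then have "t - A * ((1 + r) / 2) \<le> 0" "t - A * ((1 - r) / 2) \<ge> 0"
    using assms by (auto simp: r_def field_simps)
  then have "(t - A * ((1 + r) / 2)) * (t - A * ((1 - r) / 2)) \<le> 0"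
    by (rule mult_nonpos_nonneg)
  also have "(t - A * ((1 + r) / 2)) * (t - A * ((1 - r) / 2)) = t^2 - A * t - A^2 * (r^2 - 1) / 4"
    by (simp add: field_simps power2_eq_square)
  finally show ?thesis by (simp add: r)
qed

text \<open>\<open>\<Delta>t_max\<close> is the positive root of \<open>t^2 = 2/9 * (\<sigma> *
  \<Delta>x^2 * t + \<epsilon>^2 * \<Delta>x^2)\<close>; the claim follows on division by
  \<open>(\<epsilon> * \<Delta>x)^2\<close>.\<close>

lemma le_\<Delta>t_max_imp:
  fixes \<sigma> \<epsilon> \<Delta>x \<Delta>t :: real
  assumes "\<sigma> > 0" "\<epsilon> > 0" "\<Delta>x > 0" "\<Delta>t > 0" "\<Delta>t \<le> \<Delta>t_max \<sigma> \<epsilon> \<Delta>x"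
  shows "(\<Delta>t / (\<epsilon> * \<Delta>x))^2 \<le> 2 * (1 + stiffness \<sigma> \<epsilon> \<Delta>t) / 9"
proof -
  have "\<Delta>t^2 \<le> \<sigma> * \<Delta>x^2 / (9/2) * \<Delta>t
      + (\<sigma> * \<Delta>x^2 / (9/2))^2 * (9/2 * (2 * \<epsilon> / (\<sigma> * \<Delta>x))^2) / 4"
    using assms unfolding \<Delta>t_max_def by (intro le_positive_root_imp) auto
  also have "\<dots> = (2 * (1 + stiffness \<sigma> \<epsilon> \<Delta>t) / 9) * (\<epsilon> * \<Delta>x)^2"
    using assms by (simp add: stiffness_def field_simps power2_eq_square)
  finally show ?thesis
    using assms by (simp only: power_divide) (subst pos_divide_le_eq, auto)
qed

section \<open>The update as a combination of old values\<close>

lemma abs_convex_combination_le: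
  fixes B :: real
  assumes "p1 \<ge> 0" "p2 \<ge> 0" "p3 \<ge> 0" "q1 \<ge> 0" "q2 \<ge> 0" "q3 \<ge> 0"
    and "p1 + p2 + p3 + q1 + q2 + q3 = 1"
    and "\<bar>y1\<bar> \<le> B" "\<bar>y2\<bar> \<le> B" "\<bar>y3\<bar> \<le> B" "\<bar>z1\<bar> \<le> B" "\<bar>z2\<bar> \<le> B" "\<bar>z3\<bar> \<le> B"
  shows "\<bar>p1 * y1 + p2 * y2 + p3 * y3 + q1 * z1 + q2 * z2 + q3 * z3\<bar> \<le> B"
proof -
  have *: "\<bar>p * y\<bar> \<le> p * B" if "p \<ge> 0" "\<bar>y\<bar> \<le> B" for p y
    using that by (simp add: abs_mult mult_left_mono)
  have "\<bar>p1 * y1 + p2 * y2 + p3 * y3 + q1 * z1 + q2 * z2 + q3 * z3\<bar>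
      \<le> p1 * B + p2 * B + p3 * B + q1 * B + q2 * B + q3 * B"
    by (intro order_trans[OF abs_triangle_ineq] add_mono * assms)
  also have "\<dots> = (p1 + p2 + p3 + q1 + q2 + q3) * B" by (simp add: distrib_right)
  finally show ?thesis using assms(7) by simp
qed

text \<open>Multiplication by \<open>\<Delta>t\<close> solves for the new values; the physical
  parameters then survive only through \<open>x\<close> and \<open>s\<close>.\<close>

lemma imex2_ctr_update:
  fixes \<sigma> \<epsilon> \<Delta>x \<Delta>t :: real
  assumes pos: "\<sigma> > 0" "\<epsilon> > 0" "\<Delta>x > 0" "\<Delta>t > 0"
    and scheme: "imex2_ctr \<sigma> \<epsilon> \<Delta>x \<Delta>t N E F" and j: "j \<in> {1..N}"
  defines "s \<equiv> stiffness \<sigma> \<epsilon> \<Delta>t" and "x \<equiv> \<Delta>t / (\<epsilon> * \<Delta>x)"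
  shows "E (n+1) j = E n j - M1 s * x / 2 * (F n (j+1) - F n (j-1))
      + M1_plus s * (x^2 / 2) * (E n (j+1) - 2 * E n j + E n (j-1))" (is "_ = ?E")
    and "F (n+1) j = F n j - M2 s * x / 2 * (E n (j+1) - E n (j-1))
      + M2_plus s * (x^2 / 2) * (F n (j+1) - 2 * F n j + F n (j-1))
      - s * M2 s / 6 * (F n (j+1) + 4 * F n j + F n (j-1))" (is "_ = ?F")
proof -
  have "(E (n+1) j - E n j) / \<Delta>t
         + M1 s / \<epsilon> * ((F n (j+1) - F n (j-1)) / (2 * \<Delta>x))
         - M1_plus s * \<Delta>t / (2 * \<epsilon>^2) * ((E n (j+1) - 2 * E n j + E n (j-1)) / \<Delta>x^2) = 0"
    (is "?l = 0")
    and "(F (n+1) j - F n j) / \<Delta>t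
         + M2 s / \<epsilon> * ((E n (j+1) - E n (j-1)) / (2 * \<Delta>x))
         - M2_plus s * \<Delta>t / (2 * \<epsilon>^2) * ((F n (j+1) - 2 * F n j + F n (j-1)) / \<Delta>x^2)
       = - (\<sigma> * M2 s / \<epsilon>^2) * ((F n (j+1) + 4 * F n j + F n (j-1)) / 6)" (is "?m = ?r")
    using scheme j unfolding imex2_ctr_def s_def Let_def by auto
  then have "\<Delta>t * ?l = \<Delta>t * 0" "\<Delta>t * ?m = \<Delta>t * ?r"
    by simp_all
  moreover have "\<Delta>t * (a + b - c) = \<Delta>t * a + \<Delta>t * b - \<Delta>t * c" for a b c
    by (simp add: algebra_simps)
  moreover have "\<Delta>t * (w / \<Delta>t) = w" "\<Delta>t * (m / \<epsilon> * (w / (2 * \<Delta>x))) = m * x / 2 * w"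
    "\<Delta>t * (m * \<Delta>t / (2 * \<epsilon>^2) * (w / \<Delta>x^2)) = m * (x^2 / 2) * w"
    "\<Delta>t * (- (\<sigma> * m / \<epsilon>^2) * (w / 6)) = - (s * m / 6 * w)" for m w
    using pos by (simp_all add: x_def s_def stiffness_def power2_eq_square mult_ac)
  ultimately show "E (n+1) j = ?E" "F (n+1) j = ?F"
    by (simp_all only:)
qed

text \<open>The square roots symmetrize the coupling:
  \<open>sqrt (M2 s) * M1 s = sqrt (M1 s * M2 s) * sqrt (M1 s)\<close>, and likewise with the
  indices exchanged. Hence the centred differences give \<open>u\<close> and \<open>v\<close> each a
  transport term in itself alone, with opposite signs of \<alpha>. The variables mix only through
  \<open>d1 - d2\<close> and \<open>k\<close>.\<close>

lemma u_tilde_v_tilde_update: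
  fixes \<sigma> \<epsilon> \<Delta>x \<Delta>t :: real
  assumes pos: "\<sigma> > 0" "\<epsilon> > 0" "\<Delta>x > 0" "\<Delta>t > 0"
    and scheme: "imex2_ctr \<sigma> \<epsilon> \<Delta>x \<Delta>t N E F" and j: "j \<in> {1..N}"
  defines "s \<equiv> stiffness \<sigma> \<epsilon> \<Delta>t" and "x \<equiv> \<Delta>t / (\<epsilon> * \<Delta>x)"
  defines "u \<equiv> u_tilde s E F" and "v \<equiv> v_tilde s E F"
    and "d1 \<equiv> M1_plus s * (x^2 / 2)" and "d2 \<equiv> M2_plus s * (x^2 / 2)"
    and "k \<equiv> s * M2 s / 6" and "\<alpha> \<equiv> x / 2 * sqrt (M1 s * M2 s)"
  shows "u (n+1) j = (1 - d1 - d2 - 2*k) * u n j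
      + ((d1 + d2 - k) / 2 - \<alpha>) * u n (j+1) + ((d1 + d2 - k) / 2 + \<alpha>) * u n (j-1)
      + (d2 - d1 + 2*k) * v n j + (d1 - d2 + k) / 2 * v n (j+1) + (d1 - d2 + k) / 2 * v n (j-1)"
    and "v (n+1) j = (1 - d1 - d2 - 2*k) * v n j
      + ((d1 + d2 - k) / 2 + \<alpha>) * v n (j+1) + ((d1 + d2 - k) / 2 - \<alpha>) * v n (j-1)
      + (d2 - d1 + 2*k) * u n j + (d1 - d2 + k) / 2 * u n (j+1) + (d1 - d2 + k) / 2 * u n (j-1)"
proof -
  have "s \<ge> 0" using pos by (simp add: s_def stiffness_def)
  define a where "a = sqrt (M1 s)"
  define b where "b = sqrt (M2 s)"
  have ab: "M1 s = a^2" "M2 s = b^2" "\<alpha> = x / 2 * a * b"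
    using M1_pos[OF \<open>s \<ge> 0\<close>] M2_pos[OF \<open>s \<ge> 0\<close>]
    by (auto simp: a_def b_def \<alpha>_def real_sqrt_mult)
  note EF = imex2_ctr_update[OF pos scheme j, of n, folded s_def x_def, folded d1_def d2_def k_def,
      unfolded ab(1,2)]
  \<comment> \<open>Both identities are checked after expansion in \<open>E\<close> and
    \<open>F\<close>, as polynomial identities in \<open>a\<close> and \<open>b\<close>, rather than
    by solving for \<open>E\<close> and \<open>F\<close>.\<close>
  have uv: "u m i = b * E m i + a * F m i" "v m i = b * E m i - a * F m i" for m i
    by (auto simp: u_def v_def u_tilde_def v_tilde_def a_def b_def)
  show "u (n+1) j = (1 - d1 - d2 - 2*k) * u n j
      + ((d1 + d2 - k) / 2 - \<alpha>) * u n (j+1) + ((d1 + d2 - k) / 2 + \<alpha>) * u n (j-1)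
      + (d2 - d1 + 2*k) * v n j + (d1 - d2 + k) / 2 * v n (j+1) + (d1 - d2 + k) / 2 * v n (j-1)"
    unfolding uv EF ab(3)
    by (simp add: algebra_simps add_divide_distrib diff_divide_distrib power2_eq_square)
  show "v (n+1) j = (1 - d1 - d2 - 2*k) * v n j
      + ((d1 + d2 - k) / 2 + \<alpha>) * v n (j+1) + ((d1 + d2 - k) / 2 - \<alpha>) * v n (j-1)
      + (d2 - d1 + 2*k) * u n j + (d1 - d2 + k) / 2 * u n (j+1) + (d1 - d2 + k) / 2 * u n (j-1)"
    unfolding uv EF ab(3)
    by (simp add: algebra_simps add_divide_distrib diff_divide_distrib power2_eq_square)
qed

section \<open>Maximum principle, given control of the ghost cells\<close>

text \<open>Boundary conditions enter only through \<open>ghosts\<close>, so one argument serves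
  both kinds. That hypothesis concerns the larger of the two absolute values, since a reflection may
  exchange \<open>u\<close> and \<open>v\<close>.\<close>

lemma linf_diminishing_if_ghosts:
  fixes \<sigma> \<epsilon> \<Delta>x \<Delta>t :: real
  assumes pos: "\<sigma> > 0" "\<epsilon> > 0" "\<Delta>x > 0" "\<Delta>t > 0" and "N \<ge> 1"
    and s: "s = stiffness \<sigma> \<epsilon> \<Delta>t"
    and "\<Delta>t_min \<sigma> \<epsilon> \<Delta>x \<le> \<Delta>t" and "\<Delta>t \<le> \<Delta>t_max \<sigma> \<epsilon> \<Delta>x"
    and scheme: "imex2_ctr \<sigma> \<epsilon> \<Delta>x \<Delta>t N E F"
  defines "u \<equiv> u_tilde s E F" and "v \<equiv> v_tilde s E F"
  assumes ghosts: "\<And>n j. j \<in> {0, N+1} \<Longrightarrow>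
    \<exists>i\<in>{1..N}. max \<bar>u n j\<bar> \<bar>v n j\<bar> = max \<bar>u n i\<bar> \<bar>v n i\<bar>"
  shows "linf_diminishing N u v"
  unfolding linf_diminishing_def
proof
  fix n
  define B where "B = Max ((\<lambda>j. max \<bar>u n j\<bar> \<bar>v n j\<bar>) ` {1..N})"
  have *: "max \<bar>u n i\<bar> \<bar>v n i\<bar> \<le> B" if "i \<in> {1..N}" for i
    unfolding B_def using that by (intro Max_ge) auto
  \<comment> \<open>The updates of cells 1 and \<open>N\<close> read the indices 0 and
    \<open>N+1\<close>, so the bound has to cover them too.\<close>
  have "max \<bar>u n i\<bar> \<bar>v n i\<bar> \<le> B" if "i \<le> N+1" for i
  proof (cases "i \<in> {1..N}")
    case False
    then have "i \<in> {0, N+1}" using that by auto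
    with ghosts[of i n] * show ?thesis by metis
  qed (rule *)
  then have B: "\<bar>u n i\<bar> \<le> B" "\<bar>v n i\<bar> \<le> B" if "i \<le> N+1" for i
    using that by auto
  define x where "x = \<Delta>t / (\<epsilon> * \<Delta>x)"
  have "s \<ge> 0" "x \<ge> 0" using pos by (auto simp: s stiffness_def x_def)
  have lower: "x + s/6 \<le> x^2" and upper: "x^2 \<le> 2 * (1 + s) / 9"
    using \<Delta>t_min_iff[of \<epsilon> \<Delta>x \<Delta>t \<sigma>] le_\<Delta>t_max_imp[of \<sigma> \<epsilon> \<Delta>x \<Delta>t] assms by (auto simp: x_def s)
  define d1 d2 k \<alpha> where coeff_defs:
    "d1 = M1_plus s * (x^2 / 2)" "d2 = M2_plus s * (x^2 / 2)"
    "k = s * M2 s / 6" "\<alpha> = x / 2 * sqrt (M1 s * M2 s)"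
  have "k \<ge> 0" "\<alpha> \<ge> 0" "d1 \<ge> d2"
    using \<open>s \<ge> 0\<close> \<open>x \<ge> 0\<close> M1_pos[of s] M2_pos[of s] M2_plus_le_M1_plus[of s]
    by (auto simp: coeff_defs intro!: mult_right_mono)
  moreover have "d1 + d2 + 2*k \<le> 1"
    using coefficient_same_cell_same_variable[OF \<open>s \<ge> 0\<close> upper]
    by (simp add: coeff_defs algebra_simps add_divide_distrib diff_divide_distrib)
  moreover have "d1 - d2 \<le> 2*k"
    using coefficient_same_cell_other_variable[OF \<open>s \<ge> 0\<close> upper]
    by (simp add: coeff_defs algebra_simps add_divide_distrib diff_divide_distrib)
  moreover have "2*\<alpha> + k \<le> d1 + d2"
    using coefficient_neighbour_same_variable[OF \<open>s \<ge> 0\<close> \<open>x \<ge> 0\<close> lower]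
    by (simp add: coeff_defs algebra_simps add_divide_distrib diff_divide_distrib)
  \<comment> \<open>Five weights suffice for both updates: passing from \<open>u\<close> to
    \<open>v\<close> swaps the two neighbour weights, and the cross weight is the same for both
    neighbours.\<close>
  ultimately have coeffs: "0 \<le> 1 - d1 - d2 - 2*k" "0 \<le> (d1 + d2 - k) / 2 - \<alpha>"
    "0 \<le> (d1 + d2 - k) / 2 + \<alpha>" "0 \<le> d2 - d1 + 2*k" "0 \<le> (d1 - d2 + k) / 2"
    by auto
  have "max \<bar>u (n+1) j\<bar> \<bar>v (n+1) j\<bar> \<le> B" if j: "j \<in> {1..N}" for j
  proof -
    note update = u_tilde_v_tilde_update[OF pos scheme j, of n,
        folded s x_def, folded u_def v_def coeff_defs]
    have ind: "j \<le> N+1" "j+1 \<le> N+1" "j-1 \<le> N+1" using j by auto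
    \<comment> \<open>In the sum of the six weights all of \<open>d1\<close>, \<open>d2\<close>,
      \<open>k\<close> and \<alpha> cancel, leaving 1.\<close>
    have "\<bar>u (n+1) j\<bar> \<le> B" "\<bar>v (n+1) j\<bar> \<le> B"
      unfolding update by (rule abs_convex_combination_le; (intro coeffs B ind)?; simp add: field_simps)+
    then show ?thesis by simp
  qed
  then show "Max ((\<lambda>j. max \<bar>u (n+1) j\<bar> \<bar>v (n+1) j\<bar>) ` {1..N}) \<le> B"
    using \<open>N \<ge> 1\<close> by (subst Max_le_iff) auto
qed

section \<open>Ghost values under the two boundary conditions\<close>

lemma periodic_ghosts:
  assumes "periodic_bc N E F" "N \<ge> 1" "j \<in> {0, N+1}"
  shows "\<exists>i\<in>{1..N}. max \<bar>u_tilde s E F n j\<bar> \<bar>v_tilde s E F n j\<bar>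
    = max \<bar>u_tilde s E F n i\<bar> \<bar>v_tilde s E F n i\<bar>"
  using assms(3)
proof (elim insertE emptyE)
  assume "j = 0"
  then show ?thesis using assms(1,2)
    by (intro bexI[of _ N]) (auto simp: periodic_bc_def u_tilde_def v_tilde_def)
next
  assume "j = N+1"
  then show ?thesis using assms(1,2)
    by (intro bexI[of _ 1]) (auto simp: periodic_bc_def u_tilde_def v_tilde_def)
qed

text \<open>Across either boundary \<open>E\<close> is reflected oddly and \<open>F\<close> evenly,
  so \<open>u\<close> at the ghost is \<open>-v\<close> in the adjacent cell and vice versa.\<close>

lemma homogeneous_hybrid_ghosts:
  assumes "hybrid_bc \<Delta>x 0 0 N E F" "\<Delta>x > 0" "N \<ge> 1" "j \<in> {0, N+1}"
  shows "\<exists>i\<in>{1..N}. max \<bar>u_tilde s E F n j\<bar> \<bar>v_tilde s E F n j\<bar>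
    = max \<bar>u_tilde s E F n i\<bar> \<bar>v_tilde s E F n i\<bar>"
proof -
  have bc: "E n 0 = - E n 1" "F n 0 = F n 1" "E n (N+1) = - E n N" "F n (N+1) = F n N"
    using assms(1,2) unfolding hybrid_bc_def by (auto simp: add_eq_0_iff)
  obtain i where i: "i \<in> {1..N}" "E n j = - E n i" "F n j = F n i"
    using assms(3,4) bc by (cases "j = 0") (auto intro: that[of 1] that[of N])
  then have "u_tilde s E F n j = - v_tilde s E F n i" "v_tilde s E F n j = - u_tilde s E F n i"
    by (auto simp: u_tilde_def v_tilde_def)
  then show ?thesis using i(1) by (intro bexI[of _ i]) (auto simp: max.commute)
qed

section \<open>Differences of solutions and the conclusion\<close>

lemma imex2_ctr_diff:
  assumes "imex2_ctr \<sigma> \<epsilon> \<Delta>x \<Delta>t N E F" "imex2_ctr \<sigma> \<epsilon> \<Delta>x \<Delta>t N E' F'"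
  shows "imex2_ctr \<sigma> \<epsilon> \<Delta>x \<Delta>t N (\<lambda>n j. E n j - E' n j) (\<lambda>n j. F n j - F' n j)"
proof -
  \<comment> \<open>The shapes match the unfolded scheme, so rewriting with them turns each equation
    for the difference into the difference of the two given equations.\<close>
  have split:
    "(e1 - e1' - (e0 - e0')) / t + c * ((fp - fp' - (fm - fm')) / w)
        - d * ((ep - ep' - 2 * (e0 - e0') + (em - em')) / y)
      = ((e1 - e0) / t + c * ((fp - fm) / w) - d * ((ep - 2 * e0 + em) / y))
        - ((e1' - e0') / t + c * ((fp' - fm') / w) - d * ((ep' - 2 * e0' + em') / y))"
    "r * ((ep - ep' + 4 * (e0 - e0') + (em - em')) / 6)
      = r * ((ep + 4 * e0 + em) / 6) - r * ((ep' + 4 * e0' + em') / 6)"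
    for e0 e0' e1 e1' ep ep' em em' fp fp' fm fm' c d r t w y :: real
    by (simp_all add: diff_divide_distrib add_divide_distrib algebra_simps)
  show ?thesis
    using assms unfolding imex2_ctr_def Let_def split by auto
qed

text \<open>The shared imposed values cancel, which brings arbitrary \<open>E_L\<close> and
  \<open>E_R\<close> back to the homogeneous case.\<close>

lemma hybrid_bc_diff:
  assumes "hybrid_bc \<Delta>x E_L E_R N E F" "hybrid_bc \<Delta>x E_L E_R N E' F'"
  shows "hybrid_bc \<Delta>x 0 0 N (\<lambda>n j. E n j - E' n j) (\<lambda>n j. F n j - F' n j)"
proof -
  have split: "(a - a' + (b - b')) / c = (a + b) / c - (a' + b') / c"
    "(a - a' - (b - b')) / c = (a - b) / c - (a' - b') / c" for a a' b b' c :: real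
    by (simp_all add: diff_divide_distrib add_divide_distrib)
  show ?thesis
    using assms unfolding hybrid_bc_def split by (simp only: diff_self simp_thms)
qed

theorem theorem5p1:
  fixes \<sigma> \<epsilon> \<Delta>x \<Delta>t E_L E_R s :: real
    and N :: nat
    and E F :: grid
  assumes "\<sigma> > 0" and "\<epsilon> > 0" and "\<Delta>x > 0" and "\<Delta>t > 0" and "N \<ge> 1"
    and "s = stiffness \<sigma> \<epsilon> \<Delta>t"
    and "\<Delta>t_min \<sigma> \<epsilon> \<Delta>x \<le> \<Delta>t" and "\<Delta>t \<le> \<Delta>t_max \<sigma> \<epsilon> \<Delta>x"
    and "imex2_ctr \<sigma> \<epsilon> \<Delta>x \<Delta>t N E F"
    and "periodic_bc N E F \<or> hybrid_bc \<Delta>x E_L E_R N E F"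
  shows "(periodic_bc N E F \<or> (E_L = 0 \<and> E_R = 0)
            \<longrightarrow> linf_diminishing N (u_tilde s E F) (v_tilde s E F))
       \<and> (\<forall>E' F'. hybrid_bc \<Delta>x E_L E_R N E F \<and> hybrid_bc \<Delta>x E_L E_R N E' F'
                   \<and> imex2_ctr \<sigma> \<epsilon> \<Delta>x \<Delta>t N E' F'
            \<longrightarrow> linf_diminishing N
                  (\<lambda>n j. u_tilde s E F n j - u_tilde s E' F' n j)
                  (\<lambda>n j. v_tilde s E F n j - v_tilde s E' F' n j))"
proof (intro conjI impI allI; (elim conjE)?)
  note diminishing = linf_diminishing_if_ghosts[OF assms(1-8)]
  show "linf_diminishing N (u_tilde s E F) (v_tilde s E F)"
    if "periodic_bc N E F \<or> (E_L = 0 \<and> E_R = 0)"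
  proof (cases "periodic_bc N E F")
    case True
    then show ?thesis
      by (intro diminishing assms(9) periodic_ghosts assms(5))
  next
    case False
    with that assms(10) have "hybrid_bc \<Delta>x 0 0 N E F" by auto
    then show ?thesis
      by (intro diminishing assms(9) homogeneous_hybrid_ghosts[OF _ assms(3,5)])
  qed
  fix E' F'
  assume bc: "hybrid_bc \<Delta>x E_L E_R N E F" "hybrid_bc \<Delta>x E_L E_R N E' F'"
    and scheme': "imex2_ctr \<sigma> \<epsilon> \<Delta>x \<Delta>t N E' F'"
  let ?E = "\<lambda>n j. E n j - E' n j" and ?F = "\<lambda>n j. F n j - F' n j"
  have "linf_diminishing N (u_tilde s ?E ?F) (v_tilde s ?E ?F)"
    by (intro diminishing imex2_ctr_diff assms(9) scheme'
        homogeneous_hybrid_ghosts[OF hybrid_bc_diff[OF bc] assms(3,5)])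
  \<comment> \<open>Linearity in \<open>E\<close> and \<open>F\<close> carries the homogeneous
    result over to the differences.\<close>
  moreover have "u_tilde s ?E ?F = (\<lambda>n j. u_tilde s E F n j - u_tilde s E' F' n j)"
    "v_tilde s ?E ?F = (\<lambda>n j. v_tilde s E F n j - v_tilde s E' F' n j)"
    by (auto simp: u_tilde_def v_tilde_def algebra_simps fun_eq_iff)
  ultimately show "linf_diminishing N
      (\<lambda>n j. u_tilde s E F n j - u_tilde s E' F' n j)
      (\<lambda>n j. v_tilde s E F n j - v_tilde s E' F' n j)" by simp
qed

end
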